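(* Let $\alpha, \beta, \gamma \in (0,1)$ with $\gamma < \min\{\frac{\alpha}{\beta}, \frac{\beta}{\alpha}\}$. Then: (1) for $d$ sufficiently large, $W(\alpha, \beta, \gamma)$ is decreasing in $\alpha$ and in $\beta$ and increasing in $\gamma$; (2) for $d$ sufficiently large, $W(\alpha, \beta, \beta)$ is decreasing in $\beta$.
   Context: For $\alpha,\beta,\gamma\in(0,1)$, $W(\alpha,\beta,\gamma) = \Pr_{X \sim \mathcal{U}(\mathcal{S}^{d-1})} (X_1 > \alpha,\ X_1 \gamma + X_2 \sqrt{1 - \gamma^2} > \beta)$, where $\mathcal{U}(\mathcal{S}^{d-1})$ is the uniform distribution on the Euclidean unit sphere in $\mathbb{R}^d$; equivalently, the relative volume of the intersection of the spherical caps $\{u:\langle u,x\rangle\ge\alpha\}$ and $\{u:\langle u,y\rangle\ge\beta\}$ for unit vectors $x,y$ with $\langle x,y\rangle=\gamma$. For $0<\gamma\le\min\{\alpha/\beta,\beta/\alpha\}$ one has $W(\alpha,\beta,\gamma)=d^{\Theta(1)}\left(\frac{1-\alpha^2-\beta^2-\gamma^2+2\alpha\beta\gamma}{1-\gamma^2}\right)^{d/2}$; the monotonicity is understood for this asymptotic expression (ignoring the $d^{\Theta(1)}$ factor). *)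

theory Defs
  imports "HOL-Analysis.Analysis"
begin

definition W_base :: "real \<Rightarrow> real \<Rightarrow> real \<Rightarrow> real" where
  "W_base a b g = (1 - a\<^sup>2 - b\<^sup>2 - g\<^sup>2 + 2 * a * b * g) / (1 - g\<^sup>2)"

text \<open>Asymptotic expression of W in dimension d (the d^Theta(1) factor dropped):
  (W_base)^(d/2), with a non-positive base (empty cap intersection) read as 0.\<close>
definition W_asym :: "nat \<Rightarrow> real \<Rightarrow> real \<Rightarrow> real \<Rightarrow> real" where
  "W_asym d a b g = (sqrt (max 0 (W_base a b g))) ^ d"

definition W_adm :: "real \<Rightarrow> real \<Rightarrow> real \<Rightarrow> bool" where
  "W_adm a b g \<longleftrightarrow> 0 < a \<and> a < 1 \<and> 0 < b \<and> b < 1 \<and> 0 < g \<and> g < 1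
     \<and> g < min (a / b) (b / a)"

end

theory Submission
  imports Defs
begin

text \<open>Completing the square in \<open>a\<close> and in \<open>1 - a\<close> rewrites the base as
  \<open>1 - b\<^sup>2 - (a - b g)\<^sup>2 / (1 - g\<^sup>2)\<close> and, on the diagonal \<open>g = b\<close>, as
  \<open>2 (1 - a) - (1 - a)\<^sup>2 / (1 - b\<^sup>2)\<close>; monotonicity in \<open>a\<close>, \<open>b\<close> and along the diagonal
  is then read off. Monotonicity in \<open>g\<close> follows after cross-multiplying, since the
  difference factors as \<open>(g' - g)\<close> times a sum of products of the positive quantities
  \<open>a - b g\<close>, \<open>b - a g\<close>, which is exactly where \<open>g < min (a/b) (b/a)\<close> enters. The
  power \<open>d/2\<close> preserves all these comparisons, for every \<open>d\<close>.\<close>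

lemma W_asym_mono:
  assumes "W_base a b g \<le> W_base a' b' g'"
  shows "W_asym d a b g \<le> W_asym d a' b' g'"
  unfolding W_asym_def using assms by (intro power_mono) auto

lemma W_base_swap: "W_base b a g = W_base a b g"
  unfolding W_base_def by (simp add: algebra_simps)

lemma W_base_completed_square:
  assumes "g\<^sup>2 \<noteq> 1"
  shows "W_base a b g = 1 - b\<^sup>2 - (a - b * g)\<^sup>2 / (1 - g\<^sup>2)"
  using assms unfolding W_base_def by (simp add: field_simps power2_eq_square)

lemma W_base_diagonal:
  assumes "b\<^sup>2 \<noteq> 1"
  shows "W_base a b b = 2 * (1 - a) - (1 - a)\<^sup>2 / (1 - b\<^sup>2)"
  using assms unfolding W_base_def by (simp add: field_simps power2_eq_square)

lemma W_base_antimono_fst: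
  assumes "g\<^sup>2 < 1" "b * g \<le> a" "a \<le> a'"
  shows "W_base a' b g \<le> W_base a b g"
proof -
  have "(a - b * g)\<^sup>2 \<le> (a' - b * g)\<^sup>2"
    using assms by (intro power_mono) auto
  then have "(a - b * g)\<^sup>2 / (1 - g\<^sup>2) \<le> (a' - b * g)\<^sup>2 / (1 - g\<^sup>2)"
    using assms(1) by (intro divide_right_mono) auto
  then show ?thesis
    using assms(1) by (simp add: W_base_completed_square)
qed

lemma W_base_mono_trd:
  assumes "0 \<le> a" "0 \<le> b" "g\<^sup>2 < 1" "g'\<^sup>2 < 1" "g \<le> g'"
    and "b * g' \<le> a" "a * g' \<le> b"
  shows "W_base a b g \<le> W_base a b g'"
proof -
  have "b * g \<le> a" "a * g \<le> b"
    using assms mult_left_mono[of g g'] by (metis order_trans)+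
  then have cross: "0 \<le> (a - b * g) * (b - a * g') + (a - b * g') * (b - a * g)"
    using assms by (intro add_nonneg_nonneg mult_nonneg_nonneg) auto
  have "(1 - a\<^sup>2 - b\<^sup>2 - g'\<^sup>2 + 2 * a * b * g') * (1 - g\<^sup>2)
      - (1 - a\<^sup>2 - b\<^sup>2 - g\<^sup>2 + 2 * a * b * g) * (1 - g'\<^sup>2)
      = (g' - g) * ((a - b * g) * (b - a * g') + (a - b * g') * (b - a * g))"
    by (simp add: algebra_simps power2_eq_square)
  also have "\<dots> \<ge> 0"
    using cross assms(5) by simp
  finally show ?thesis
    using assms(3,4) unfolding W_base_def by (simp add: divide_le_eq le_divide_eq mult.commute)
qed

lemma W_base_antimono_diagonal:
  assumes "b\<^sup>2 \<le> b'\<^sup>2" "b'\<^sup>2 < 1"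
  shows "W_base a b' b' \<le> W_base a b b"
proof -
  have "(1 - a)\<^sup>2 / (1 - b\<^sup>2) \<le> (1 - a)\<^sup>2 / (1 - b'\<^sup>2)"
    using assms by (intro divide_left_mono mult_pos_pos) auto
  then show ?thesis
    using assms by (simp add: W_base_diagonal)
qed

lemma W_adm_bounds:
  assumes "W_adm a b g"
  shows "0 < a" "0 < b" "g\<^sup>2 < 1" "b * g < a" "a * g < b"
  using assms by (auto simp: W_adm_def field_simps abs_square_less_1)

theorem lemma4:
  shows "\<exists>D::nat. \<forall>d\<ge>D.
     (\<forall>a a' b g. W_adm a b g \<and> W_adm a' b g \<and> a \<le> a' \<longrightarrow> W_asym d a' b g \<le> W_asym d a b g)
   \<and> (\<forall>a b b' g. W_adm a b g \<and> W_adm a b' g \<and> b \<le> b' \<longrightarrow> W_asym d a b' g \<le> W_asym d a b g)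
   \<and> (\<forall>a b g g'. W_adm a b g \<and> W_adm a b g' \<and> g \<le> g' \<longrightarrow> W_asym d a b g \<le> W_asym d a b g')
   \<and> (\<forall>a b b'. W_adm a b b \<and> W_adm a b' b' \<and> b \<le> b' \<longrightarrow> W_asym d a b' b' \<le> W_asym d a b b)"
proof (intro exI[of _ 0] allI impI conjI; elim conjE; rule W_asym_mono)
  fix a a' b g :: real
  assume "W_adm a b g" "a \<le> a'"
  then show "W_base a' b g \<le> W_base a b g"
    by (intro W_base_antimono_fst) (auto dest: W_adm_bounds)
next
  fix a b b' g :: real
  assume "W_adm a b g" "b \<le> b'"
  then have "W_base b' a g \<le> W_base b a g"
    by (intro W_base_antimono_fst) (auto dest: W_adm_bounds)
  then show "W_base a b' g \<le> W_base a b g"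
    by (simp add: W_base_swap)
next
  fix a b g g' :: real
  assume "W_adm a b g" "W_adm a b g'" "g \<le> g'"
  then show "W_base a b g \<le> W_base a b g'"
    by (intro W_base_mono_trd) (auto dest: W_adm_bounds)
next
  fix a b b' :: real
  assume "W_adm a b b" "W_adm a b' b'" "b \<le> b'"
  then show "W_base a b' b' \<le> W_base a b b"
    by (intro W_base_antimono_diagonal power_mono) (auto dest: W_adm_bounds)
qed

end
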